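(* Let $R\ge R_0=\|x^0-x^*\|$ and let $Q=B_{2R}(x^* )$, where $x^*$ is the unique solution of $F(x)=0$. Assume that - (bounded variance) $\mathbb{E}\|F_\xi(x)-F(x)\|^2\le\sigma^2$ for all $x\in Q$; - (quasi-strong monotonicity) for some $\mu\ge0$, $\langle F(x),x-x^*\rangle\ge\mu\|x-x^*\|^2$ for all $x\in Q$; - (star-cocoercivity) for some $\ell>0$, $\|F(x)\|^2\le\ell\langle F(x),x-x^*\rangle$ for all $x\in Q$. Let $$0<\gamma\le\frac1{400\ell\ln\frac{4(K+1)}\beta},\qquad\lambda_k=\frac{\exp(-\gamma\mu(1+k/2))R}{120\gamma\ln\frac{4(K+1)}\beta},$$ $$m_k\ge\max\left\{1,\frac{27000\gamma^2(K+1)\sigma^2\ln\frac{4(K+1)}\beta}{\exp(-\gamma\mu k)R^2}\right\}$$ for some integer $K\ge0$ and $\beta\in(0,1]$ such that $\ln\frac{4(K+1)}\beta\ge1$. Then, after $K$ iterations, the iterates produced by clipped-SGDA satisfy with probability at least $1-\beta$ $$\|x^{K+1}-x^*\|^2\le2\exp(-\gamma\mu(K+1))R^2.$$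
   Context: Notation: $\|\cdot\|$ is the Euclidean norm, $B_r(x)=\{u\in\mathbb{R}^d:\|u-x\|\le r\}$. $F:\mathbb{R}^d\to\mathbb{R}^d$ with $F(x)=\mathbb{E}_{\xi\sim\mathcal D}[F_\xi(x)]$ for all $x$, where $F_\xi(x)$ is a stochastic oracle; $x^0$ is the starting point. $\mathrm{clip}(y,\lambda)=\min\{1,\lambda/\|y\|\}y$ for $y\ne0$, $\mathrm{clip}(0,\lambda)=0$, for $\lambda>0$. clipped-SGDA, for $k=0,1,\dots$: $x^{k+1}=x^k-\gamma\widetilde F_{\boldsymbol\xi^k}(x^k)$, $\widetilde F_{\boldsymbol\xi^k}(x^k)=\mathrm{clip}\left(\frac1{m_k}\sum_{i=1}^{m_k}F_{\xi^{i,k}}(x^k),\lambda_k\right)$, where all $\xi^{i,k}$ are independent samples from $\mathcal D$. Clipping levels are positive (so $R>0$), batchsizes are positive integers. *)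

theory Defs
  imports "HOL-Probability.Probability"
begin

definition clip :: "real ^ 'd \<Rightarrow> real \<Rightarrow> real ^ 'd" where
  "clip y r = (if y = 0 then 0 else min 1 (r / norm y) *\<^sub>R y)"

text \<open>\<open>Fo x s\<close> is the oracle value at the point \<open>x\<close> for the sample \<open>s\<close>.  Joint measurability is
  the regularity implicit in calling it a stochastic oracle: it makes the oracle evaluated at
  a random point, hence every iterate below, a random variable.  Integrability is needed because
  the Bochner integral of a non-integrable function is 0 by convention.\<close>

definition stochastic_oracle ::
  "'s measure \<Rightarrow> (real ^ 'd \<Rightarrow> 's \<Rightarrow> real ^ 'd) \<Rightarrow> (real ^ 'd \<Rightarrow> real ^ 'd) \<Rightarrow> bool" where
  "stochastic_oracle D Fo F \<longleftrightarrow>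
     (\<lambda>(x, s). Fo x s) \<in> borel_measurable (borel \<Otimes>\<^sub>M D) \<and>
     (\<forall>x. integrable D (Fo x) \<and> F x = (LINT s|D. Fo x s))"

definition bounded_variance_on ::
  "'s measure \<Rightarrow> (real ^ 'd \<Rightarrow> 's \<Rightarrow> real ^ 'd) \<Rightarrow> (real ^ 'd \<Rightarrow> real ^ 'd) \<Rightarrow> real
     \<Rightarrow> (real ^ 'd) set \<Rightarrow> bool" where
  "bounded_variance_on D Fo F \<sigma> Q \<longleftrightarrow>
     (\<forall>x\<in>Q. integrable D (\<lambda>s. (norm (Fo x s - F x))\<^sup>2) \<and>
            (LINT s|D. (norm (Fo x s - F x))\<^sup>2) \<le> \<sigma>\<^sup>2)"

definition quasi_strongly_monotone_on ::
  "(real ^ 'd \<Rightarrow> real ^ 'd) \<Rightarrow> real ^ 'd \<Rightarrow> real \<Rightarrow> (real ^ 'd) set \<Rightarrow> bool" where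
  "quasi_strongly_monotone_on F xs \<mu> Q \<longleftrightarrow>
     (\<forall>x\<in>Q. F x \<bullet> (x - xs) \<ge> \<mu> * (norm (x - xs))\<^sup>2)"

definition star_cocoercive_on ::
  "(real ^ 'd \<Rightarrow> real ^ 'd) \<Rightarrow> real ^ 'd \<Rightarrow> real \<Rightarrow> (real ^ 'd) set \<Rightarrow> bool" where
  "star_cocoercive_on F xs l Q \<longleftrightarrow>
     (\<forall>x\<in>Q. (norm (F x))\<^sup>2 \<le> l * (F x \<bullet> (x - xs)))"

text \<open>\<open>\<xi> k i\<close> is the \<open>i\<close>-th sample drawn in iteration \<open>k\<close>, where \<open>1 \<le> i \<le> m k\<close>; all these samples,
  over all iterations, are mutually independent with law \<open>D\<close>.\<close>

definition independent_samples ::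
  "'w measure \<Rightarrow> 's measure \<Rightarrow> (nat \<Rightarrow> nat) \<Rightarrow> (nat \<Rightarrow> nat \<Rightarrow> 'w \<Rightarrow> 's) \<Rightarrow> bool" where
  "independent_samples M D m \<xi> \<longleftrightarrow>
     prob_space.indep_vars M (\<lambda>_. D) (\<lambda>(k, i). \<xi> k i) (SIGMA k:UNIV. {1..m k}) \<and>
     (\<forall>k. \<forall>i\<in>{1..m k}. distr M D (\<xi> k i) = D)"

primrec clipped_sgda ::
  "(real ^ 'd \<Rightarrow> 's \<Rightarrow> real ^ 'd) \<Rightarrow> real \<Rightarrow> (nat \<Rightarrow> real) \<Rightarrow> (nat \<Rightarrow> nat)
     \<Rightarrow> (nat \<Rightarrow> nat \<Rightarrow> 'w \<Rightarrow> 's) \<Rightarrow> real ^ 'd \<Rightarrow> nat \<Rightarrow> 'w \<Rightarrow> real ^ 'd" where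
  "clipped_sgda Fo \<gamma> lam m \<xi> x0 0 \<omega> = x0"
| "clipped_sgda Fo \<gamma> lam m \<xi> x0 (Suc k) \<omega> =
     (let x = clipped_sgda Fo \<gamma> lam m \<xi> x0 k \<omega>
      in x - \<gamma> *\<^sub>R clip ((1 / real (m k)) *\<^sub>R (\<Sum>i = 1..m k. Fo x (\<xi> k i \<omega>))) (lam k))"

end

theory Submission imports Defs begin

text \<open>Put \<open>A = ln (4 (K + 1) / \<beta>)\<close> and \<open>V\<^sub>k = exp (\<gamma> \<mu> k) \<parallel>x\<^sup>k - x\<^sup>*\<parallel>\<^sup>2 / R\<^sup>2\<close>.  As long as
  \<open>V\<^sub>k \<le> 2\<close>, the iterate is in \<open>Q\<close> and \<open>\<parallel>F x\<^sup>k\<parallel> \<le> \<lambda>\<^sub>k / 2\<close>, so clipping, the projection onto the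
  \<open>\<lambda>\<^sub>k\<close>-ball, does not increase the distance of the batch mean \<open>Y\<close> to \<open>F x\<^sup>k\<close> and moves it by at
  most \<open>2 \<parallel>Y - F x\<^sup>k\<parallel>\<^sup>2 / \<lambda>\<^sub>k\<close>.  Hence the conditional expectation of \<open>exp (2 A V\<^sub>k\<^sub>+\<^sub>1)\<close> is at
  most \<open>exp (A / (K + 1)) exp (2 A V\<^sub>k)\<close>.  For the process stopped when \<open>V\<^sub>k\<close> exceeds \<open>2\<close>, the
  expectation of \<open>exp (2 A min 2 V\<^sub>k)\<close> therefore grows from at most \<open>exp (2 A)\<close> to at most
  \<open>exp (3 A)\<close> in \<open>K + 1\<close> steps, and Markov's inequality bounds the probability of ever stopping by
  \<open>exp (3 A - 4 A) \<le> \<beta>\<close>.\<close>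

section \<open>Elementary inequalities for the exponential and for clipping\<close>

lemma exp_le_quadratic:
  fixes x :: real
  assumes "\<bar>x\<bar> \<le> 1"
  shows "exp x \<le> 1 + x + x\<^sup>2"
proof (cases "x \<ge> 0")
  case True
  then show ?thesis using exp_bound assms by simp
next
  case False
  have "1 + (- x) \<le> exp (- x)" by (rule exp_ge_add_one_self)
  then have "exp x \<le> 1 / (1 - x)"
    using False by (simp add: exp_minus field_simps)
  also have "\<dots> \<le> 1 + x + x\<^sup>2"
  proof -
    have "(1 + x + x\<^sup>2) * (1 - x) = 1 + x\<^sup>2 * (- x)" by (simp add: algebra_simps power2_eq_square)
    moreover have "x\<^sup>2 * (- x) \<ge> 0" using False by (intro mult_nonneg_nonneg) auto
    ultimately show ?thesis using False by (simp add: pos_divide_le_eq)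
  qed
  finally show ?thesis .
qed

lemma norm_clip_le:
  assumes "r > 0"
  shows "norm (clip y r) \<le> r"
  using assms by (auto simp: clip_def min_def field_simps)

text \<open>If clipping is active, it scales \<open>y\<close> by \<open>t = r / norm y\<close>, and
  the squared distances to \<open>f\<close> differ by (1 - t) ((1 + t) |y|^2 - 2 <y, f>). This is
  nonnegative because 2 <y, f> is at most r |y|, hence at most |y|^2.\<close>

lemma norm_clip_diff_le:
  assumes "norm f \<le> r / 2"
  shows "norm (clip y r - f) \<le> norm (y - f)"
proof (cases "norm y \<le> r \<or> y = 0")
  case True
  then have "clip y r = y"
    by (auto simp: clip_def min_def field_simps)
  then show ?thesis by simp
next
  case False
  define t where "t = r / norm y"
  have y: "norm y > r" "norm y > 0" using False by auto
  have r: "r \<ge> 0" using assms norm_ge_zero[of f] by linarith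
  have t: "0 \<le> t" "t < 1" "t * norm y = r" using y r by (auto simp: t_def)
  have c: "clip y r = t *\<^sub>R y" using y t by (auto simp: clip_def t_def)
  have "y \<bullet> f \<le> norm y * norm f" by (rule norm_cauchy_schwarz)
  also have "\<dots> \<le> norm y * (r / 2)" using assms by (intro mult_left_mono) auto
  finally have "2 * (y \<bullet> f) \<le> norm y * norm y"
    using y mult_left_mono[of r "norm y" "norm y"] by linarith
  also have "\<dots> = 1 * (norm y)\<^sup>2" by (simp add: power2_eq_square)
  also have "\<dots> \<le> (1 + t) * (norm y)\<^sup>2" using t(1) by (intro mult_right_mono) auto
  finally have "(1 - t) * (2 * (y \<bullet> f)) \<le> (1 - t) * ((1 + t) * (norm y)\<^sup>2)"
    using t by (intro mult_left_mono) auto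
  then have "(norm (clip y r - f))\<^sup>2 \<le> (norm (y - f))\<^sup>2"
    unfolding c power2_norm_eq_inner
    by (simp add: inner_simps inner_commute algebra_simps)
  then show ?thesis by (rule power2_le_imp_le) simp
qed

text \<open>Active clipping forces \<open>y\<close> to be at distance d of at least r/2 from
  \<open>f\<close>, so the displacement, which is at most d, is also at most d (2d/r). The quadratic
  form matters: the bias of the clipped estimator is then controlled by the variance alone.\<close>

lemma norm_clip_bias_le:
  assumes "norm f \<le> r / 2" and "r > 0"
  shows "norm (clip y r - y) \<le> 2 * (norm (y - f))\<^sup>2 / r"
proof (cases "norm y \<le> r \<or> y = 0")
  case True
  then have "clip y r = y"
    by (auto simp: clip_def min_def field_simps)
  then show ?thesis using assms by simp
next
  case False
  define d where "d = norm (y - f)"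
  have y: "norm y > r" "norm y > 0" using False by auto
  have "clip y r - y = - ((1 - r / norm y) *\<^sub>R y)"
    using y assms by (auto simp: clip_def algebra_simps)
  then have "norm (clip y r - y) = \<bar>1 - r / norm y\<bar> * norm y" by simp
  also have "\<dots> = norm y - r" using y assms by (simp add: abs_if field_simps)
  finally have n: "norm (clip y r - y) = norm y - r" .
  have "norm y \<le> d + norm f" unfolding d_def by norm
  then have d: "norm y - r \<le> d" "r / 2 \<le> d" "d \<ge> 0" using assms y by (auto simp: d_def)
  have "d * r \<le> 2 * d\<^sup>2" using mult_left_mono[OF d(2,3)] by (simp add: power2_eq_square)
  then have "d \<le> 2 * d\<^sup>2 / r" using assms by (simp add: field_simps)
  then show ?thesis using n d by (simp add: d_def)
qed

section \<open>Deterministic estimates for a single step\<close>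

text \<open>The gain 2 \<gamma> <f, p> is spent in two halves. By cocoercivity and the step size
  bound, one half pays for the term in |f|^2, which the parallelogram law separates from the noise
  \<theta>; by monotonicity, the other half gives the contraction.\<close>

lemma gradient_step_descent:
  fixes p f \<theta> :: "'a::real_inner"
  assumes "\<gamma> \<ge> 0" and "\<mu> \<ge> 0" and "\<gamma> * l \<le> 1 / 2"
    and "(norm f)\<^sup>2 \<le> l * (f \<bullet> p)" and "f \<bullet> p \<ge> \<mu> * (norm p)\<^sup>2"
  shows "(norm (p - \<gamma> *\<^sub>R (f + \<theta>)))\<^sup>2
    \<le> (1 - \<gamma> * \<mu>) * (norm p)\<^sup>2 - 2 * \<gamma> * (\<theta> \<bullet> p) + 2 * \<gamma>\<^sup>2 * (norm \<theta>)\<^sup>2"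
proof -
  have "(norm (f + \<theta>))\<^sup>2 + (norm (f - \<theta>))\<^sup>2 = 2 * (norm f)\<^sup>2 + 2 * (norm \<theta>)\<^sup>2"
    by (simp add: power2_norm_eq_inner inner_simps inner_commute)
  then have "(norm (f + \<theta>))\<^sup>2 \<le> 2 * (l * (f \<bullet> p)) + 2 * (norm \<theta>)\<^sup>2"
    using assms(4) zero_le_power2[of "norm (f - \<theta>)"] by linarith
  then have 1: "\<gamma>\<^sup>2 * (norm (f + \<theta>))\<^sup>2 \<le> \<gamma>\<^sup>2 * (2 * (l * (f \<bullet> p)) + 2 * (norm \<theta>)\<^sup>2)"
    by (intro mult_left_mono) auto
  have fp: "f \<bullet> p \<ge> 0" using assms(2,5) by (meson mult_nonneg_nonneg order_trans zero_le_power2)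
  have "\<gamma> * l * (2 * \<gamma> * (f \<bullet> p)) \<le> 1 / 2 * (2 * \<gamma> * (f \<bullet> p))"
    using assms fp by (intro mult_right_mono) auto
  then have 2: "\<gamma>\<^sup>2 * (2 * (l * (f \<bullet> p))) \<le> \<gamma> * (f \<bullet> p)" by (simp add: power2_eq_square mult_ac)
  have 3: "\<gamma> * (\<mu> * (norm p)\<^sup>2) \<le> \<gamma> * (f \<bullet> p)" using assms by (intro mult_left_mono)
  have "(norm (p - \<gamma> *\<^sub>R (f + \<theta>)))\<^sup>2
      = (norm p)\<^sup>2 - 2 * \<gamma> * (f \<bullet> p) - 2 * \<gamma> * (\<theta> \<bullet> p) + \<gamma>\<^sup>2 * (norm (f + \<theta>))\<^sup>2"
    unfolding power2_norm_eq_inner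
    by (simp add: inner_simps inner_commute algebra_simps power2_eq_square)
  then show ?thesis using 1 2 3 by (simp add: algebra_simps)
qed

text \<open>Here \<open>W\<close> is the weight at the current time and the factor \<open>q\<close>
  updates its square. The exponent grows by at most a quantity U with |U| at most 1, so
  \<open>exp_le_quadratic\<close> applies. The clipped noise is then traded for the raw noise
  \<open>y - f\<close>, leaving a linear term, which averages to zero, and a quadratic term governed
  by the variance.\<close>

lemma clipped_step_exp_bound:
  fixes p f y :: "real ^ 'd"
  assumes "\<gamma> > 0" and "A \<ge> 1" and "W > 0" and "q \<ge> 1" and "q \<le> 11 / 10"
    and "\<mu> \<ge> 0" and "l > 0" and "\<gamma> * l * A \<le> 1 / 400" and "q * (1 - \<gamma> * \<mu>) \<le> 1"
    and "r = 1 / (120 * \<gamma> * A * q * W)"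
    and "W * norm p \<le> 3 / 2"
    and "(norm f)\<^sup>2 \<le> l * (f \<bullet> p)" and "f \<bullet> p \<ge> \<mu> * (norm p)\<^sup>2"
  shows "exp (2 * A * (q * W\<^sup>2 * (norm (p - \<gamma> *\<^sub>R clip y r))\<^sup>2))
    \<le> exp (2 * A * (W\<^sup>2 * (norm p)\<^sup>2))
       * (1 - 4 * \<gamma> * A * q * W\<^sup>2 * ((y - f) \<bullet> p)
          + 1500 * (\<gamma> * A * q * W)\<^sup>2 * (norm (y - f))\<^sup>2)"
proof -
  \<comment> \<open>The scale for which \<open>g * r = 1 / 120\<close>.\<close>
  define g where "g = \<gamma> * A * q * W"
  have g: "g > 0" using assms by (simp add: g_def)
  have rg: "r = 1 / (120 * g)" "r > 0" using assms(10) g by (auto simp: g_def mult_ac)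
  have f0: "norm f \<le> l * norm p"
  proof (cases "f = 0")
    case False
    have "norm f * norm f \<le> l * (norm f * norm p)"
      using assms(12) norm_cauchy_schwarz[of f p] \<open>l > 0\<close>
      by (smt (verit) mult_left_mono power2_eq_square)
    then have "norm f * norm f \<le> norm f * (l * norm p)" by (simp add: mult_ac)
    then show ?thesis using False by simp
  qed (use \<open>l > 0\<close> in simp)
  \<comment> \<open>The constant 400 in the step size is used here: (1/400)(11/10)(3/2) = 33/8000 is
    just below 1/240, and \<open>r / 2\<close> equals 1/(240 g).\<close>
  have fr: "norm f \<le> r / 2"
  proof -
    have "g * norm f \<le> g * (l * norm p)" using f0 g by simp
    also have "\<dots> = (\<gamma> * l * A) * q * (W * norm p)" by (simp add: g_def mult_ac)
    also have "\<dots> \<le> (1 / 400) * (11 / 10) * (3 / 2)"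
      using assms by (intro mult_mono) auto
    finally have "g * norm f \<le> 1 / 240" by simp
    then show ?thesis using g by (simp add: rg field_simps)
  qed
  define \<theta> where "\<theta> = clip y r - f"
  define T where "T = norm \<theta>"
  define D where "D = norm (y - f)"
  have TD: "T \<le> D" unfolding T_def D_def \<theta>_def by (rule norm_clip_diff_le[OF fr])
  have T0: "T \<ge> 0" by (simp add: T_def)
  \<comment> \<open>Clipping makes the noise bounded surely, by r + r/2, however large
    \<open>y\<close> is. This keeps the exponent increment small.\<close>
  have "T \<le> norm (clip y r) + norm f" unfolding T_def \<theta>_def by (rule norm_triangle_ineq4)
  then have "T \<le> 3 / 2 * r" using norm_clip_le[OF rg(2), of y] fr by linarith
  then have "g * T \<le> g * (3 / 2 * r)" using g by simp
  then have gT: "g * T \<le> 1 / 80" using g by (simp add: rg)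
  have gl: "\<gamma> * l \<le> 1 / 2"
  proof -
    have "\<gamma> * l * 1 \<le> \<gamma> * l * A" using assms by (intro mult_left_mono) auto
    then show ?thesis using assms by linarith
  qed
  define b where "b = 4 * \<gamma> * A * q * W\<^sup>2"
  have b: "b = 4 * g * W" "b \<ge> 0" using assms by (auto simp: b_def g_def power2_eq_square)
  \<comment> \<open>The noise terms of \<open>gradient_step_descent\<close> multiplied by
    \<open>2 * A * q * W\<^sup>2\<close>. The contraction term is handled separately by
    \<open>q * (1 - \<gamma> * \<mu>) \<le> 1\<close>.\<close>
  define U where "U = - b * (\<theta> \<bullet> p) + b * \<gamma> * T\<^sup>2"
  have expo: "2 * A * (q * W\<^sup>2 * (norm (p - \<gamma> *\<^sub>R clip y r))\<^sup>2) \<le> 2 * A * (W\<^sup>2 * (norm p)\<^sup>2) + U"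
  proof -
    have "(norm (p - \<gamma> *\<^sub>R clip y r))\<^sup>2
      \<le> (1 - \<gamma> * \<mu>) * (norm p)\<^sup>2 - 2 * \<gamma> * (\<theta> \<bullet> p) + 2 * \<gamma>\<^sup>2 * T\<^sup>2"
      using gradient_step_descent[of \<gamma> \<mu> l f p \<theta>] assms gl unfolding \<theta>_def T_def by simp
    then have "2 * A * (q * W\<^sup>2) * (norm (p - \<gamma> *\<^sub>R clip y r))\<^sup>2
      \<le> 2 * A * (q * W\<^sup>2) * ((1 - \<gamma> * \<mu>) * (norm p)\<^sup>2 - 2 * \<gamma> * (\<theta> \<bullet> p) + 2 * \<gamma>\<^sup>2 * T\<^sup>2)"
      using assms by (intro mult_left_mono) auto
    also have "\<dots> = 2 * A * W\<^sup>2 * (norm p)\<^sup>2 * (q * (1 - \<gamma> * \<mu>)) + U"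
      by (simp add: U_def b_def algebra_simps power2_eq_square)
    also have "\<dots> \<le> 2 * A * W\<^sup>2 * (norm p)\<^sup>2 * 1 + U"
      using assms by (intro add_right_mono mult_left_mono) auto
    finally show ?thesis by (simp add: mult_ac)
  qed
  have bp: "b * norm p \<le> 6 * g"
  proof -
    have "b * norm p = 4 * g * (W * norm p)" by (simp add: b)
    also have "\<dots> \<le> 4 * g * (3 / 2)" using assms g by (intro mult_left_mono) auto
    finally show ?thesis by simp
  qed
  have tp: "\<bar>b * (\<theta> \<bullet> p)\<bar> \<le> 6 * (g * T)"
  proof -
    have "\<bar>b * (\<theta> \<bullet> p)\<bar> \<le> b * (T * norm p)"
      unfolding abs_mult T_def using b Cauchy_Schwarz_ineq2[of \<theta> p] by (simp add: mult_left_mono)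
    also have "\<dots> = (b * norm p) * T" by simp
    also have "\<dots> \<le> 6 * g * T" using bp T0 by (intro mult_right_mono)
    finally show ?thesis by simp
  qed
  \<comment> \<open>The left side carries only one factor A q; a second one may be inserted since A
    q is at least 1.\<close>
  have bg: "b * \<gamma> \<le> 4 * g\<^sup>2"
  proof -
    have "b * \<gamma> = 4 * (\<gamma> * W)\<^sup>2 * ((A * q) * 1)" by (simp add: b_def power2_eq_square)
    also have "\<dots> \<le> 4 * (\<gamma> * W)\<^sup>2 * ((A * q) * (A * q))"
      using assms mult_mono[of 1 A 1 q] by (intro mult_left_mono) auto
    also have "\<dots> = 4 * g\<^sup>2" by (simp add: g_def power2_eq_square)
    finally show ?thesis .
  qed
  then have "b * \<gamma> * T\<^sup>2 \<le> 4 * g\<^sup>2 * T\<^sup>2" by (rule mult_right_mono) simp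
  then have T2: "b * \<gamma> * T\<^sup>2 \<le> 4 * (g * T)\<^sup>2" by (simp add: power_mult_distrib)
  \<comment> \<open>As g T is at most 1/80, the bound 6 g T + 4 (g T)^2 on |U| is below 7 g T, hence
    below 1.\<close>
  have "(g * T)\<^sup>2 \<le> (g * T) * (1 / 80)"
    unfolding power2_eq_square using gT g T0 by (intro mult_left_mono) auto
  moreover have "0 \<le> b * \<gamma> * T\<^sup>2" using b assms by simp
  moreover have "U = b * \<gamma> * T\<^sup>2 - b * (\<theta> \<bullet> p)" by (simp add: U_def)
  moreover have "0 \<le> g * T" using g T0 by simp
  ultimately have U7: "\<bar>U\<bar> \<le> 7 * (g * T)" using tp T2 by linarith
  then have U1: "\<bar>U\<bar> \<le> 1" using gT by linarith
  have "U\<^sup>2 \<le> (7 * (g * T))\<^sup>2" using U7 abs_le_square_iff[of U "7 * (g * T)"] g T0 by simp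
  also have "\<dots> \<le> 49 * g\<^sup>2 * D\<^sup>2"
    using TD T0 g by (simp add: power_mult_distrib power_mono)
  finally have U2: "U\<^sup>2 \<le> 49 * g\<^sup>2 * D\<^sup>2" .
  \<comment> \<open>The noise \<theta> splits into \<open>y - f\<close> and the clipping bias. The
    bias contributes (2/r) D^2 = 240 g D^2 times b |p|, at most 6 g, giving 1440; the term in T^2
    adds 4.\<close>
  have Ule: "U \<le> - b * ((y - f) \<bullet> p) + 1444 * g\<^sup>2 * D\<^sup>2"
  proof -
    have "\<theta> \<bullet> p = (y - f) \<bullet> p + (clip y r - y) \<bullet> p"
      by (simp add: \<theta>_def inner_simps)
    moreover have "\<bar>(clip y r - y) \<bullet> p\<bar> \<le> (2 * D\<^sup>2 / r) * norm p"
      using Cauchy_Schwarz_ineq2[of "clip y r - y" p] norm_clip_bias_le[OF fr rg(2), of y]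
      unfolding D_def by (meson mult_right_mono norm_ge_zero order_trans)
    ultimately have "- (\<theta> \<bullet> p) \<le> - ((y - f) \<bullet> p) + (2 * D\<^sup>2 / r) * norm p" by linarith
    then have "b * - (\<theta> \<bullet> p) \<le> b * (- ((y - f) \<bullet> p) + (2 * D\<^sup>2 / r) * norm p)"
      using b by (intro mult_left_mono)
    also have "\<dots> = - b * ((y - f) \<bullet> p) + (240 * g * D\<^sup>2) * (b * norm p)"
      by (simp add: rg algebra_simps)
    also have "\<dots> \<le> - b * ((y - f) \<bullet> p) + (240 * g * D\<^sup>2) * (6 * g)"
      using bp g by (intro add_left_mono mult_left_mono) auto
    finally have "- b * (\<theta> \<bullet> p) \<le> - b * ((y - f) \<bullet> p) + 1440 * g\<^sup>2 * D\<^sup>2"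
      by (simp add: power2_eq_square mult_ac)
    moreover have "(g * T)\<^sup>2 \<le> g\<^sup>2 * D\<^sup>2"
      using TD T0 by (simp add: power_mult_distrib power_mono mult_left_mono)
    ultimately show ?thesis using T2 unfolding U_def by linarith
  qed
  have "exp U \<le> 1 + U + U\<^sup>2" using U1 by (rule exp_le_quadratic)
  \<comment> \<open>The constant is 1444 from U plus 49 from its square; it is then rounded up to
    1500.\<close>
  also have "\<dots> \<le> 1 - b * ((y - f) \<bullet> p) + 1493 * g\<^sup>2 * D\<^sup>2" using Ule U2 by simp
  also have "\<dots> \<le> 1 - b * ((y - f) \<bullet> p) + 1500 * g\<^sup>2 * D\<^sup>2"
    by (intro add_left_mono mult_right_mono) auto
  finally have eU: "exp U \<le> 1 - b * ((y - f) \<bullet> p) + 1500 * g\<^sup>2 * D\<^sup>2" .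
  have "exp (2 * A * (q * W\<^sup>2 * (norm (p - \<gamma> *\<^sub>R clip y r))\<^sup>2))
      \<le> exp (2 * A * (W\<^sup>2 * (norm p)\<^sup>2)) * exp U"
    using expo by (simp flip: exp_add)
  also have "\<dots> \<le> exp (2 * A * (W\<^sup>2 * (norm p)\<^sup>2))
       * (1 - b * ((y - f) \<bullet> p) + 1500 * g\<^sup>2 * D\<^sup>2)"
    using eU by (intro mult_left_mono) auto
  finally show ?thesis by (simp add: b_def g_def D_def)
qed

section \<open>Moments of batch means, and integrating out an independent variable\<close>

context prob_space
begin

lemma integrable_norm_power2_diff_const:
  fixes Z :: "'a \<Rightarrow> 'b::euclidean_space"
  assumes "integrable M (\<lambda>\<omega>. (norm (Z \<omega> - a))\<^sup>2)"
    and [measurable]: "Z \<in> borel_measurable M"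
  shows "integrable M Z"
proof -
  have "integrable M (\<lambda>\<omega>. Z \<omega> - a)"
  proof (rule Bochner_Integration.integrable_bound[of _ "\<lambda>\<omega>. 1 + (norm (Z \<omega> - a))\<^sup>2"])
    show "AE \<omega> in M. norm (Z \<omega> - a) \<le> norm (1 + (norm (Z \<omega> - a))\<^sup>2)"
    proof (rule AE_I2)
      fix \<omega>
      have "0 \<le> (norm (Z \<omega> - a) - 1)\<^sup>2" by simp
      then show "norm (Z \<omega> - a) \<le> norm (1 + (norm (Z \<omega> - a))\<^sup>2)"
        unfolding real_norm_def
        by (smt (verit) power2_diff norm_ge_zero power_one mult_cancel_left2)
    qed
  qed (use assms in auto)
  then have "integrable M (\<lambda>\<omega>. (Z \<omega> - a) + a)" by (intro Bochner_Integration.integrable_add) auto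
  then show ?thesis by simp
qed

text \<open>Expanding the inner product in the basis reduces both claims to the product rule for
  independent real variables, one coordinate at a time.\<close>

lemma indep_var_expectation_inner:
  fixes X Y :: "'a \<Rightarrow> 'b::euclidean_space"
  assumes "indep_var borel X borel Y" and "integrable M X" and "integrable M Y"
  shows "integrable M (\<lambda>\<omega>. X \<omega> \<bullet> Y \<omega>)"
    and "expectation (\<lambda>\<omega>. X \<omega> \<bullet> Y \<omega>) = expectation X \<bullet> expectation Y"
proof -
  have ind: "indep_var borel (\<lambda>\<omega>. X \<omega> \<bullet> b) borel (\<lambda>\<omega>. Y \<omega> \<bullet> b)" for b
    using indep_var_compose[OF assms(1), of "\<lambda>x. x \<bullet> b" borel "\<lambda>x. x \<bullet> b" borel]
    by (simp add: comp_def)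
  have int: "integrable M (\<lambda>\<omega>. (X \<omega> \<bullet> b) * (Y \<omega> \<bullet> b))" for b
    using assms by (intro indep_var_integrable ind) auto
  have ex: "expectation (\<lambda>\<omega>. (X \<omega> \<bullet> b) * (Y \<omega> \<bullet> b)) = (expectation X \<bullet> b) * (expectation Y \<bullet> b)" for b
    using assms by (subst indep_var_lebesgue_integral[OF ind]) auto
  show "integrable M (\<lambda>\<omega>. X \<omega> \<bullet> Y \<omega>)"
    by (subst euclidean_inner) (intro Bochner_Integration.integrable_sum int)
  show "expectation (\<lambda>\<omega>. X \<omega> \<bullet> Y \<omega>) = expectation X \<bullet> expectation Y"
    by (subst (1 2) euclidean_inner) (simp add: int ex)
qed

text \<open>The squared norm expands into a double sum in which independence and zero means
  annihilate the off-diagonal terms.\<close>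

lemma indep_vars_second_moment_sum:
  fixes Z :: "'i \<Rightarrow> 'a \<Rightarrow> 'b::euclidean_space"
  assumes I: "finite I" and ind: "indep_vars (\<lambda>_. borel) Z I"
    and sq: "\<And>i. i \<in> I \<Longrightarrow> integrable M (\<lambda>\<omega>. (norm (Z i \<omega>))\<^sup>2)"
    and zero: "\<And>i. i \<in> I \<Longrightarrow> expectation (Z i) = 0"
  shows "integrable M (\<lambda>\<omega>. (norm (\<Sum>i\<in>I. Z i \<omega>))\<^sup>2)"
    and "expectation (\<lambda>\<omega>. (norm (\<Sum>i\<in>I. Z i \<omega>))\<^sup>2) = (\<Sum>i\<in>I. expectation (\<lambda>\<omega>. (norm (Z i \<omega>))\<^sup>2))"
proof -
  have meas: "Z i \<in> borel_measurable M" if "i \<in> I" for i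
    using ind that by (auto simp: indep_vars_def)
  have intZ: "integrable M (Z i)" if "i \<in> I" for i
    using integrable_norm_power2_diff_const[of "Z i" 0] sq[OF that] meas[OF that] by simp
  have prod: "integrable M (\<lambda>\<omega>. Z i \<omega> \<bullet> Z j \<omega>) \<and> expectation (\<lambda>\<omega>. Z i \<omega> \<bullet> Z j \<omega>)
      = (if j = i then expectation (\<lambda>\<omega>. (norm (Z i \<omega>))\<^sup>2) else 0)"
    if ij: "i \<in> I" "j \<in> I" for i j
  proof (cases "i = j")
    case True
    then show ?thesis using sq[OF ij(1)] by (simp add: power2_norm_eq_inner)
  next
    case False
    have "indep_var borel (Z i) borel (Z j)"
    proof -
      \<comment> \<open>Pairwise independence comes from restricting the family to the disjoint
        index sets {i} and {j} and reading off the single coordinate.\<close>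
      have "indep_var borel ((\<lambda>f. f i) \<circ> (\<lambda>\<omega>. restrict (\<lambda>i. Z i \<omega>) {i}))
          borel ((\<lambda>f. f j) \<circ> (\<lambda>\<omega>. restrict (\<lambda>i. Z i \<omega>) {j}))"
        using ij False by (intro indep_var_compose[OF indep_var_restrict[OF ind]]) auto
      then show ?thesis by (simp add: comp_def)
    qed
    then show ?thesis
      using indep_var_expectation_inner[of "Z i" "Z j"] intZ ij False by (simp add: zero)
  qed
  have eq: "(norm (\<Sum>i\<in>I. Z i \<omega>))\<^sup>2 = (\<Sum>i\<in>I. \<Sum>j\<in>I. Z i \<omega> \<bullet> Z j \<omega>)" for \<omega>
    unfolding power2_norm_eq_inner inner_sum_left by (simp only: inner_sum_right)
  show "integrable M (\<lambda>\<omega>. (norm (\<Sum>i\<in>I. Z i \<omega>))\<^sup>2)"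
    unfolding eq using prod by (intro Bochner_Integration.integrable_sum) auto
  have "expectation (\<lambda>\<omega>. (norm (\<Sum>i\<in>I. Z i \<omega>))\<^sup>2)
      = (\<Sum>i\<in>I. \<Sum>j\<in>I. expectation (\<lambda>\<omega>. Z i \<omega> \<bullet> Z j \<omega>))"
    unfolding eq using prod
    by (simp add: Bochner_Integration.integral_sum Bochner_Integration.integrable_sum)
  also have "\<dots> = (\<Sum>i\<in>I. \<Sum>j\<in>I. if j = i then expectation (\<lambda>\<omega>. (norm (Z i \<omega>))\<^sup>2) else 0)"
    using prod by (intro sum.cong) auto
  also have "\<dots> = (\<Sum>i\<in>I. expectation (\<lambda>\<omega>. (norm (Z i \<omega>))\<^sup>2))"
    using I by (simp add: sum.delta)
  finally show "expectation (\<lambda>\<omega>. (norm (\<Sum>i\<in>I. Z i \<omega>))\<^sup>2)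
      = (\<Sum>i\<in>I. expectation (\<lambda>\<omega>. (norm (Z i \<omega>))\<^sup>2))" .
qed

text \<open>The prefactor contributes 1/n^2 while the centred samples contribute only n variances,
  so averaging divides the variance bound by the batch size.\<close>

lemma batch_mean_moments:
  fixes X :: "nat \<Rightarrow> 'a \<Rightarrow> 'b::euclidean_space"
  assumes ind: "indep_vars (\<lambda>_. borel) X {1..n}" and n: "n \<ge> 1"
    and int: "\<And>i. i \<in> {1..n} \<Longrightarrow> integrable M (X i)"
    and mean: "\<And>i. i \<in> {1..n} \<Longrightarrow> expectation (X i) = a"
    and sq: "\<And>i. i \<in> {1..n} \<Longrightarrow> integrable M (\<lambda>\<omega>. (norm (X i \<omega> - a))\<^sup>2)"
    and var: "\<And>i. i \<in> {1..n} \<Longrightarrow> expectation (\<lambda>\<omega>. (norm (X i \<omega> - a))\<^sup>2) \<le> v"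
  defines "Y \<equiv> \<lambda>\<omega>. (1 / real n) *\<^sub>R (\<Sum>i = 1..n. X i \<omega>)"
  shows "integrable M Y" and "expectation Y = a"
    and "integrable M (\<lambda>\<omega>. (norm (Y \<omega> - a))\<^sup>2)"
    and "expectation (\<lambda>\<omega>. (norm (Y \<omega> - a))\<^sup>2) \<le> v / real n"
proof -
  show "integrable M Y" unfolding Y_def
    by (intro integrable_scaleR_right Bochner_Integration.integrable_sum int)
  show "expectation Y = a"
    unfolding Y_def using int mean n by (simp add: Bochner_Integration.integral_sum sum_constant_scaleR)
  define Z where "Z = (\<lambda>i \<omega>. X i \<omega> - a)"
  have indZ: "indep_vars (\<lambda>_. borel) Z {1..n}"
    unfolding Z_def using indep_vars_compose2[OF ind, of "\<lambda>_ x. x - a" "\<lambda>_. borel"] by simp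
  have zero: "expectation (Z i) = 0" if "i \<in> {1..n}" for i
    unfolding Z_def using int[OF that] mean[OF that] by (simp add: prob_space)
  have eq: "(norm (Y \<omega> - a))\<^sup>2 = (1 / real n)\<^sup>2 * (norm (\<Sum>i = 1..n. Z i \<omega>))\<^sup>2" for \<omega>
  proof -
    have "Y \<omega> - a = (1 / real n) *\<^sub>R (\<Sum>i = 1..n. Z i \<omega>)"
      using n by (simp add: Y_def Z_def sum_subtractf scaleR_diff_right sum_constant_scaleR)
    then show ?thesis by (simp add: power_divide)
  qed
  note 2 = indep_vars_second_moment_sum[OF _ indZ, unfolded Z_def, OF _ sq zero[unfolded Z_def], simplified]
  show "integrable M (\<lambda>\<omega>. (norm (Y \<omega> - a))\<^sup>2)"
    unfolding eq Z_def using 2(1) by auto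
  have "expectation (\<lambda>\<omega>. (norm (Y \<omega> - a))\<^sup>2)
      = (1 / real n)\<^sup>2 * (\<Sum>i = 1..n. expectation (\<lambda>\<omega>. (norm (X i \<omega> - a))\<^sup>2))"
    unfolding eq Z_def using 2 by simp
  also have "\<dots> \<le> (1 / real n)\<^sup>2 * (\<Sum>i = 1..n. v)"
    using var by (intro mult_left_mono sum_mono) auto
  also have "\<dots> = v / real n" using n by (simp add: power2_eq_square)
  finally show "expectation (\<lambda>\<omega>. (norm (Y \<omega> - a))\<^sup>2) \<le> v / real n" .
qed

text \<open>The joint law is a product measure, so Tonelli's theorem applies. This takes the place
  of conditioning on \<open>X\<close>: the inner integral freezes \<open>X\<close> and averages over
  a fresh copy of \<open>Y\<close>.\<close>

lemma indep_var_nn_integral: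
  assumes "indep_var N1 X N2 Y" and [measurable]: "case_prod g \<in> borel_measurable (N1 \<Otimes>\<^sub>M N2)"
  shows "(\<integral>\<^sup>+\<omega>. g (X \<omega>) (Y \<omega>) \<partial>M) = (\<integral>\<^sup>+\<omega>. (\<integral>\<^sup>+\<omega>'. g (X \<omega>) (Y \<omega>') \<partial>M) \<partial>M)"
proof -
  have X[measurable]: "X \<in> measurable M N1" and Y[measurable]: "Y \<in> measurable M N2"
    and d: "distr M N1 X \<Otimes>\<^sub>M distr M N2 Y = distr M (N1 \<Otimes>\<^sub>M N2) (\<lambda>\<omega>. (X \<omega>, Y \<omega>))"
    using assms(1) by (auto simp: indep_var_distribution_eq)
  interpret Y: prob_space "distr M N2 Y" by (rule prob_space_distr) measurable
  have "(\<integral>\<^sup>+\<omega>. g (X \<omega>) (Y \<omega>) \<partial>M)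
      = (\<integral>\<^sup>+z. case_prod g z \<partial>distr M (N1 \<Otimes>\<^sub>M N2) (\<lambda>\<omega>. (X \<omega>, Y \<omega>)))"
    by (subst nn_integral_distr) auto
  also have "\<dots> = (\<integral>\<^sup>+x. (\<integral>\<^sup>+y. g x y \<partial>distr M N2 Y) \<partial>distr M N1 X)"
    unfolding d[symmetric] by (subst Y.nn_integral_fst[symmetric]) auto
  also have "\<dots> = (\<integral>\<^sup>+\<omega>. (\<integral>\<^sup>+y. g (X \<omega>) y \<partial>distr M N2 Y) \<partial>M)"
    by (subst nn_integral_distr) auto
  also have "\<dots> = (\<integral>\<^sup>+\<omega>. (\<integral>\<^sup>+\<omega>'. g (X \<omega>) (Y \<omega>') \<partial>M) \<partial>M)"
  proof (rule nn_integral_cong)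
    fix \<omega> assume "\<omega> \<in> space M"
    then have "X \<omega> \<in> space N1" using X by (rule measurable_space[rotated])
    then have "g (X \<omega>) \<in> borel_measurable N2"
      using measurable_compose[OF measurable_Pair1' assms(2)] by simp
    then show "(\<integral>\<^sup>+y. g (X \<omega>) y \<partial>distr M N2 Y) = (\<integral>\<^sup>+\<omega>'. g (X \<omega>) (Y \<omega>') \<partial>M)"
      by (simp add: nn_integral_distr[OF Y])
  qed
  finally show ?thesis .
qed

end

section \<open>Exponential moment of a single step from a fixed point\<close>

text \<open>Taking expectations in \<open>clipped_step_exp_bound\<close> removes the linear term,
  and the quadratic one contributes at most c, where 1 + c is at most exp c.\<close>

lemma (in prob_space) clipped_step_exp_moment:
  fixes p f :: "real ^ 'd" and Y :: "'a \<Rightarrow> real ^ 'd"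
  assumes "\<gamma> > 0" and "A \<ge> 1" and "W > 0" and "q \<ge> 1" and "q \<le> 11 / 10"
    and "\<mu> \<ge> 0" and "l > 0" and "\<gamma> * l * A \<le> 1 / 400" and "q * (1 - \<gamma> * \<mu>) \<le> 1"
    and "r = 1 / (120 * \<gamma> * A * q * W)"
    and "W * norm p \<le> 3 / 2"
    and "(norm f)\<^sup>2 \<le> l * (f \<bullet> p)" and "f \<bullet> p \<ge> \<mu> * (norm p)\<^sup>2"
    and Y: "integrable M Y" "expectation Y = f"
    and sq: "integrable M (\<lambda>\<omega>. (norm (Y \<omega> - f))\<^sup>2)"
    and var: "expectation (\<lambda>\<omega>. (norm (Y \<omega> - f))\<^sup>2) \<le> v"
    and c: "1500 * (\<gamma> * A * q * W)\<^sup>2 * v \<le> c"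
  shows "(\<integral>\<^sup>+\<omega>. ennreal (exp (2 * A * (q * W\<^sup>2 * (norm (p - \<gamma> *\<^sub>R clip (Y \<omega>) r))\<^sup>2))) \<partial>M)
    \<le> ennreal (exp c) * ennreal (exp (2 * A * (W\<^sup>2 * (norm p)\<^sup>2)))"
proof -
  define E where "E = exp (2 * A * (W\<^sup>2 * (norm p)\<^sup>2))"
  define G where "G = 1500 * (\<gamma> * A * q * W)\<^sup>2"
  define h where "h = (\<lambda>\<omega>. E * (1 - 4 * \<gamma> * A * q * W\<^sup>2 * ((Y \<omega> - f) \<bullet> p) + G * (norm (Y \<omega> - f))\<^sup>2))"
  have le: "exp (2 * A * (q * W\<^sup>2 * (norm (p - \<gamma> *\<^sub>R clip (Y \<omega>) r))\<^sup>2)) \<le> h \<omega>" for \<omega>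
    unfolding h_def E_def G_def using clipped_step_exp_bound[OF assms(1-13)] .
  \<comment> \<open>The sign is not visible from the formula for \<open>h\<close>; it follows
    because \<open>h\<close> dominates an exponential. It is what allows passing from the
    nonnegative integral to the expectation.\<close>
  have h0: "0 \<le> h \<omega>" for \<omega>
    using le[of \<omega>] by (meson exp_ge_zero order_trans)
  have ip: "integrable M (\<lambda>\<omega>. (Y \<omega> - f) \<bullet> p)" "expectation (\<lambda>\<omega>. (Y \<omega> - f) \<bullet> p) = 0"
    using Y by (auto simp: prob_space)
  have h: "integrable M h" unfolding h_def using ip sq by auto
  have "expectation h = E * (1 + G * expectation (\<lambda>\<omega>. (norm (Y \<omega> - f))\<^sup>2))"
    unfolding h_def using ip sq by (simp add: prob_space)
  also have "\<dots> \<le> E * (1 + G * v)"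
    using var by (intro mult_left_mono add_left_mono) (auto simp: E_def G_def)
  also have "\<dots> \<le> E * exp c"
  proof (rule mult_left_mono)
    show "1 + G * v \<le> exp c" using c exp_ge_add_one_self[of c] unfolding G_def by linarith
  qed (simp add: E_def)
  finally have Eh: "expectation h \<le> E * exp c" .
  have "(\<integral>\<^sup>+\<omega>. ennreal (exp (2 * A * (q * W\<^sup>2 * (norm (p - \<gamma> *\<^sub>R clip (Y \<omega>) r))\<^sup>2))) \<partial>M)
      \<le> (\<integral>\<^sup>+\<omega>. ennreal (h \<omega>) \<partial>M)"
    by (intro nn_integral_mono ennreal_leI le)
  also have "\<dots> = ennreal (expectation h)"
    using h h0 by (intro nn_integral_eq_integral) auto
  also have "\<dots> \<le> ennreal (E * exp c)" using Eh by (rule ennreal_leI)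
  also have "\<dots> = ennreal (exp c) * ennreal E"
    by (simp add: E_def flip: ennreal_mult)
  finally show ?thesis by (simp add: E_def)
qed

section \<open>The stopped process, its measurability and its independence of the next batch\<close>

text \<open>\<open>C k\<close> is the region in which step k may be taken. For decreasing regions, a
  point that has left \<open>C k\<close> lies outside all later ones as well, so it is frozen
  forever: this is stopping at the first exit.\<close>

primrec stopped_sgda ::
  "(nat \<Rightarrow> (real ^ 'd) set) \<Rightarrow> (real ^ 'd \<Rightarrow> 's \<Rightarrow> real ^ 'd) \<Rightarrow> real \<Rightarrow> (nat \<Rightarrow> real) \<Rightarrow> (nat \<Rightarrow> nat)
     \<Rightarrow> (nat \<Rightarrow> nat \<Rightarrow> 'w \<Rightarrow> 's) \<Rightarrow> real ^ 'd \<Rightarrow> nat \<Rightarrow> 'w \<Rightarrow> real ^ 'd" where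
  "stopped_sgda C Fo \<gamma> lam m \<xi> x0 0 \<omega> = x0"
| "stopped_sgda C Fo \<gamma> lam m \<xi> x0 (Suc k) \<omega> =
     (let x = stopped_sgda C Fo \<gamma> lam m \<xi> x0 k \<omega>
      in if x \<in> C k
         then x - \<gamma> *\<^sub>R clip ((1 / real (m k)) *\<^sub>R (\<Sum>i = 1..m k. Fo x (\<xi> k i \<omega>))) (lam k)
         else x)"

text \<open>A frozen point could not lie in a later, smaller region. Membership at time k therefore
  certifies that every earlier step was really taken.\<close>

lemma clipped_sgda_eq_stopped_sgda:
  assumes "\<And>k. C (Suc k) \<subseteq> C k" and "stopped_sgda C Fo \<gamma> lam m \<xi> x0 k \<omega> \<in> C k"
  shows "clipped_sgda Fo \<gamma> lam m \<xi> x0 k \<omega> = stopped_sgda C Fo \<gamma> lam m \<xi> x0 k \<omega>"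
  using assms(2)
proof (induction k)
  case (Suc k)
  have "stopped_sgda C Fo \<gamma> lam m \<xi> x0 k \<omega> \<in> C k"
    using Suc.prems assms(1)[of k] by (auto simp: Let_def split: if_splits)
  then show ?case using Suc.IH by (simp add: Let_def)
qed simp

text \<open>This is adaptedness in pointwise form. The two sample families may live on different
  spaces, so the iterate can be rewritten as a function of the past samples alone.\<close>

lemma stopped_sgda_cong:
  assumes "\<And>j i. j < k \<Longrightarrow> i \<in> {1..m j} \<Longrightarrow> \<xi> j i \<omega> = \<eta> j i \<omega>'"
  shows "stopped_sgda C Fo \<gamma> lam m \<xi> x0 k \<omega> = stopped_sgda C Fo \<gamma> lam m \<eta> x0 k \<omega>'"
  using assms
proof (induction k)
  case (Suc k)
  then have IH: "stopped_sgda C Fo \<gamma> lam m \<xi> x0 k \<omega> = stopped_sgda C Fo \<gamma> lam m \<eta> x0 k \<omega>'"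
    by simp
  have "(\<Sum>i = 1..m k. Fo x (\<xi> k i \<omega>)) = (\<Sum>i = 1..m k. Fo x (\<eta> k i \<omega>'))" for x
    using Suc.prems by (intro sum.cong) auto
  then show ?case by (simp add: IH Let_def)
qed simp

lemma clip_measurable [measurable]: "(\<lambda>y. clip y r) \<in> borel_measurable borel"
  unfolding clip_def by measurable

text \<open>The space \<open>N\<close> is general because it is instantiated both by the underlying
  probability space and by the product space of past samples.\<close>

lemma stopped_sgda_measurable:
  fixes Fo :: "real ^ 'd \<Rightarrow> 's \<Rightarrow> real ^ 'd"
  assumes Fo: "(\<lambda>(x, s). Fo x s) \<in> borel_measurable (borel \<Otimes>\<^sub>M D)"
    and C: "\<And>k. C k \<in> sets borel"
    and "\<And>j i. j < k \<Longrightarrow> i \<in> {1..m j} \<Longrightarrow> \<xi> j i \<in> measurable N D"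
  shows "stopped_sgda C Fo \<gamma> lam m \<xi> x0 k \<in> borel_measurable N"
  using assms(3)
proof (induction k)
  case 0
  have "stopped_sgda C Fo \<gamma> lam m \<xi> x0 0 = (\<lambda>\<omega>. x0)" by (simp add: fun_eq_iff)
  then show ?case by simp
next
  case (Suc k)
  define X where "X = stopped_sgda C Fo \<gamma> lam m \<xi> x0 k"
  have X[measurable]: "X \<in> borel_measurable N" unfolding X_def using Suc by simp
  have [measurable]: "C k \<in> sets borel" by (rule C)
  have "(\<lambda>\<omega>. Fo (X \<omega>) (\<xi> k i \<omega>)) \<in> borel_measurable N" if "i \<in> {1..m k}" for i
    using measurable_compose[OF measurable_Pair[OF X Suc.prems[OF _ that]] Fo] by simp
  then have [measurable]: "(\<lambda>\<omega>. \<Sum>i = 1..m k. Fo (X \<omega>) (\<xi> k i \<omega>)) \<in> borel_measurable N"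
    by (rule borel_measurable_sum)
  have "(\<lambda>\<omega>. if X \<omega> \<in> C k
      then X \<omega> - \<gamma> *\<^sub>R clip ((1 / real (m k)) *\<^sub>R (\<Sum>i = 1..m k. Fo (X \<omega>) (\<xi> k i \<omega>))) (lam k)
      else X \<omega>) \<in> borel_measurable N"
    by measurable
  then show ?case unfolding X_def by (simp add: Let_def)
qed

text \<open>The iterate at time k is a function of samples with first index below k. These indices
  are disjoint from those of batch k, so \<open>indep_var_nn_integral\<close> applies to the past
  and the batch.\<close>

lemma (in prob_space) nn_integral_stopped_sgda_batch:
  fixes Fo :: "real ^ 'd \<Rightarrow> 's \<Rightarrow> real ^ 'd"
  assumes Fo: "(\<lambda>(x, s). Fo x s) \<in> borel_measurable (borel \<Otimes>\<^sub>M D)"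
    and C: "\<And>k. C k \<in> sets borel"
    and ind: "indep_vars (\<lambda>_. D) (\<lambda>(k, i). \<xi> k i) (SIGMA k:UNIV. {1..m k})"
    and g: "case_prod g \<in> borel_measurable (borel \<Otimes>\<^sub>M PiM ({k} \<times> {1..m k}) (\<lambda>_. D))"
  defines "B \<equiv> \<lambda>\<omega>. \<lambda>z\<in>{k} \<times> {1..m k}. \<xi> (fst z) (snd z) \<omega>"
  shows "(\<integral>\<^sup>+\<omega>. g (stopped_sgda C Fo \<gamma> lam m \<xi> x0 k \<omega>) (B \<omega>) \<partial>M)
    = (\<integral>\<^sup>+\<omega>. (\<integral>\<^sup>+\<omega>'. g (stopped_sgda C Fo \<gamma> lam m \<xi> x0 k \<omega>) (B \<omega>') \<partial>M) \<partial>M)"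
proof -
  define P where "P = (SIGMA j:{..<k}. {1..m j})"
  define past where "past = (\<lambda>\<omega>. \<lambda>z\<in>P. \<xi> (fst z) (snd z) \<omega>)"
  \<comment> \<open>Coordinate projections: running the recursion with them on the product space
    exhibits the iterate as a measurable function of \<open>past\<close>.\<close>
  define \<pi> :: "nat \<Rightarrow> nat \<Rightarrow> (nat \<times> nat \<Rightarrow> 's) \<Rightarrow> 's" where "\<pi> = (\<lambda>j i S. S (j, i))"
  have ind': "indep_var (PiM P (\<lambda>_. D)) past (PiM ({k} \<times> {1..m k}) (\<lambda>_. D)) B"
    using indep_var_restrict[OF ind, of P "{k} \<times> {1..m k}"]
    unfolding past_def B_def by (auto simp: P_def case_prod_unfold)
  have y: "stopped_sgda C Fo \<gamma> lam m \<pi> x0 k \<in> borel_measurable (PiM P (\<lambda>_. D))"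
    by (rule stopped_sgda_measurable[OF Fo C])
      (auto simp: \<pi>_def P_def intro!: measurable_component_singleton)
  have eq: "stopped_sgda C Fo \<gamma> lam m \<xi> x0 k \<omega> = stopped_sgda C Fo \<gamma> lam m \<pi> x0 k (past \<omega>)" for \<omega>
    by (rule stopped_sgda_cong) (auto simp: \<pi>_def P_def past_def)
  have "(\<lambda>z. (stopped_sgda C Fo \<gamma> lam m \<pi> x0 k (fst z), snd z))
    \<in> (PiM P (\<lambda>_. D)) \<Otimes>\<^sub>M (PiM ({k} \<times> {1..m k}) (\<lambda>_. D))
      \<rightarrow>\<^sub>M borel \<Otimes>\<^sub>M PiM ({k} \<times> {1..m k}) (\<lambda>_. D)"
    using y by measurable
  from measurable_compose[OF this g]
  have "case_prod (\<lambda>S. g (stopped_sgda C Fo \<gamma> lam m \<pi> x0 k S))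
    \<in> borel_measurable ((PiM P (\<lambda>_. D)) \<Otimes>\<^sub>M (PiM ({k} \<times> {1..m k}) (\<lambda>_. D)))"
    by (simp add: case_prod_unfold)
  from indep_var_nn_integral[OF ind' this] show ?thesis by (simp add: eq)
qed

text \<open>At a point of the sphere of radius r, the inner product u lies between \<mu> r^2 and l
  r^2; the upper bound combines Cauchy-Schwarz with cocoercivity and cancels one factor u. The
  result bounds \<gamma> \<mu>, and hence the growth of the weights per step.\<close>

lemma quasi_strongly_monotone_star_cocoercive_le:
  fixes F :: "real ^ 'd \<Rightarrow> real ^ 'd"
  assumes "r > 0" and "l > 0"
    and "quasi_strongly_monotone_on F xs \<mu> (cball xs r)"
    and "star_cocoercive_on F xs l (cball xs r)"
  shows "\<mu> \<le> l"
proof -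
  obtain p :: "real ^ 'd" where p: "norm p = r"
    using vector_choose_size[of r] \<open>r > 0\<close> by auto
  define u where "u = F (xs + p) \<bullet> p"
  have "xs + p \<in> cball xs r" by (simp add: p dist_norm)
  then have 1: "\<mu> * r\<^sup>2 \<le> u" and 2: "(norm (F (xs + p)))\<^sup>2 \<le> l * u"
    using assms(3,4) unfolding quasi_strongly_monotone_on_def star_cocoercive_on_def u_def
    by (metis add_diff_cancel_left' p)+
  have "u\<^sup>2 \<le> (norm (F (xs + p)) * norm p)\<^sup>2"
    unfolding u_def using Cauchy_Schwarz_ineq2 by (metis abs_ge_zero power2_abs power_mono)
  also have "\<dots> \<le> (l * u) * r\<^sup>2"
    using 2 by (simp add: power_mult_distrib p mult_right_mono)
  finally have u: "u * u \<le> u * (l * r\<^sup>2)" by (simp add: power2_eq_square mult_ac)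
  have "0 \<le> l * u" using 2 by (meson order_trans zero_le_power2)
  then have "u = 0 \<or> u > 0" using \<open>l > 0\<close> by (simp add: zero_le_mult_iff) linarith
  then have "u \<le> l * r\<^sup>2" using u \<open>l > 0\<close> by auto
  then have "\<mu> * r\<^sup>2 \<le> l * r\<^sup>2" using 1 by linarith
  then show ?thesis using \<open>r > 0\<close> by simp
qed

section \<open>Growth of the exponential moment along the stopped process, and Markov's
  inequality\<close>

theorem theoremD3:
  fixes M :: "'w measure" and D :: "'s measure"
    and Fo :: "real ^ 'd \<Rightarrow> 's \<Rightarrow> real ^ 'd" and F :: "real ^ 'd \<Rightarrow> real ^ 'd"
    and x0 xs :: "real ^ 'd" and R \<sigma> \<mu> l \<gamma> \<beta> :: real and K :: nat
    and lam :: "nat \<Rightarrow> real" and m :: "nat \<Rightarrow> nat" and \<xi> :: "nat \<Rightarrow> nat \<Rightarrow> 'w \<Rightarrow> 's"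
  assumes "prob_space M" and "prob_space D"
    and "stochastic_oracle D Fo F"
    and "F xs = 0" and "\<And>y. F y = 0 \<Longrightarrow> y = xs"
    and "R > 0" and "R \<ge> norm (x0 - xs)"
    and "bounded_variance_on D Fo F \<sigma> (cball xs (2 * R))"
    and "\<mu> \<ge> 0" and "quasi_strongly_monotone_on F xs \<mu> (cball xs (2 * R))"
    and "l > 0" and "star_cocoercive_on F xs l (cball xs (2 * R))"
    and "0 < \<beta>" and "\<beta> \<le> 1" and "ln (4 * (real K + 1) / \<beta>) \<ge> 1"
    and "0 < \<gamma>" and "\<gamma> \<le> 1 / (400 * l * ln (4 * (real K + 1) / \<beta>))"
    and "\<And>k. lam k = exp (- \<gamma> * \<mu> * (1 + real k / 2)) * R
                     / (120 * \<gamma> * ln (4 * (real K + 1) / \<beta>))"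
    and "\<And>k. m k \<ge> 1"
    and "\<And>k. k \<le> K \<Longrightarrow>
           real (m k) \<ge> max 1 (27000 * \<gamma>\<^sup>2 * (real K + 1) * \<sigma>\<^sup>2 * ln (4 * (real K + 1) / \<beta>)
                                / (exp (- \<gamma> * \<mu> * real k) * R\<^sup>2))"
    and "independent_samples M D m \<xi>"
  shows "\<P>(\<omega> in M. (norm (clipped_sgda Fo \<gamma> lam m \<xi> x0 (K + 1) \<omega> - xs))\<^sup>2
                     \<le> 2 * exp (- \<gamma> * \<mu> * (real K + 1)) * R\<^sup>2) \<ge> 1 - \<beta>"
proof -
  interpret prob_space M by fact
  define A where "A = ln (4 * (real K + 1) / \<beta>)"
  define q where "q = exp (\<gamma> * \<mu>)"
  define W where "W = (\<lambda>k. exp (\<gamma> * \<mu> * real k / 2) / R)"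
  define V where "V = (\<lambda>k x. (W k)\<^sup>2 * (norm (x - xs))\<^sup>2)"
  define C where "C = (\<lambda>k. {x. V k x \<le> 2})"
  \<comment> \<open>The truncation at 2 matters after stopping: the point is frozen but its weight
    may still grow, and the truncated value nevertheless stays constant.\<close>
  define \<phi> where "\<phi> = (\<lambda>k x. ennreal (exp (2 * A * min 2 (V k x))))"
  \<comment> \<open>The growth allowed per step; over K + 1 steps it adds up to A.\<close>
  define c where "c = A / (real K + 1)"
  let ?y = "stopped_sgda C Fo \<gamma> lam m \<xi> x0"
  have A: "A \<ge> 1" unfolding A_def by fact
  have Fo[measurable]: "(\<lambda>(x, s). Fo x s) \<in> borel_measurable (borel \<Otimes>\<^sub>M D)"
    and Fo_int: "\<And>x. integrable D (Fo x)" and F: "\<And>x. F x = (LINT s|D. Fo x s)"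
    using assms(3) by (auto simp: stochastic_oracle_def)
  have ind: "indep_vars (\<lambda>_. D) (\<lambda>(k, i). \<xi> k i) (SIGMA k:UNIV. {1..m k})"
    and dist: "\<And>k i. i \<in> {1..m k} \<Longrightarrow> distr M D (\<xi> k i) = D"
    using assms(21) by (auto simp: independent_samples_def)
  have \<xi>: "\<xi> k i \<in> measurable M D" if "i \<in> {1..m k}" for k i
    using ind that by (force simp: indep_vars_def)
  have \<gamma>lA: "\<gamma> * l * A \<le> 1 / 400"
    using assms(17)[folded A_def] A \<open>l > 0\<close> by (simp add: field_simps)
  have "\<mu> \<le> l"
    by (rule quasi_strongly_monotone_star_cocoercive_le[of "2 * R"]) (use assms(6,10,11,12) in auto)
  then have "\<gamma> * \<mu> \<le> \<gamma> * l * 1" using \<open>\<gamma> > 0\<close> by simp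
  also have "\<dots> \<le> \<gamma> * l * A" using A assms(11,16) by (intro mult_left_mono) auto
  finally have "\<gamma> * \<mu> \<le> 1 / 400" using \<gamma>lA by linarith
  then have \<gamma>\<mu>: "0 \<le> \<gamma> * \<mu>" "\<gamma> * \<mu> \<le> 1 / 400" using assms(9,16) by simp_all
  have q: "q \<ge> 1" "q \<le> 11 / 10"
  proof -
    have "(\<gamma> * \<mu>)\<^sup>2 \<le> (1 / 400)\<^sup>2" using \<gamma>\<mu> by (intro power_mono)
    then show "q \<le> 11 / 10" using exp_bound[of "\<gamma> * \<mu>"] \<gamma>\<mu> by (simp add: q_def power2_eq_square)
  qed (use \<gamma>\<mu> in \<open>simp add: q_def\<close>)
  have q\<mu>: "q * (1 - \<gamma> * \<mu>) \<le> 1"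
  proof -
    have "q * (1 - \<gamma> * \<mu>) \<le> q * exp (- (\<gamma> * \<mu>))"
      using exp_ge_add_one_self[of "- (\<gamma> * \<mu>)"] q by (intro mult_left_mono) auto
    then show ?thesis by (simp add: q_def flip: exp_add)
  qed
  have W: "W k > 0" for k using \<open>R > 0\<close> by (simp add: W_def)
  have W_Suc: "(W (Suc k))\<^sup>2 = q * (W k)\<^sup>2" for k
    by (simp add: W_def q_def power_divide algebra_simps add_divide_distrib
        flip: exp_add exp_double)
  have W2: "(W k)\<^sup>2 = exp (\<gamma> * \<mu> * real k) / R\<^sup>2" for k
    by (simp add: W_def power_divide flip: exp_double)
  have W0: "W k * R \<ge> 1" for k
    using \<open>R > 0\<close> \<gamma>\<mu> by (simp add: W_def)
  have V_Suc: "V (Suc k) x = q * V k x" for k x by (simp add: V_def W_Suc)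
  have V0: "V k x \<ge> 0" for k x by (simp add: V_def)
  have V_mono: "V k x \<le> V (Suc k) x" for k x
    unfolding V_Suc using mult_right_mono[OF q(1) V0] by simp
  have C_mono: "C (Suc k) \<subseteq> C k" for k unfolding C_def by (auto intro: order_trans[OF V_mono])
  have V_meas[measurable]: "V k \<in> borel_measurable borel" for k unfolding V_def by measurable
  have C_meas[measurable]: "C k \<in> sets borel" for k unfolding C_def by measurable
  have \<phi>_meas[measurable]: "\<phi> k \<in> borel_measurable borel" for k unfolding \<phi>_def by measurable
  have y_meas[measurable]: "?y k \<in> borel_measurable M" for k
    by (rule stopped_sgda_measurable[OF Fo C_meas]) (rule \<xi>)
  have c: "c \<ge> 0" using A by (simp add: c_def)
  have step: "(\<integral>\<^sup>+\<omega>. \<phi> (Suc k) (?y (Suc k) \<omega>) \<partial>M)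
    \<le> ennreal (exp c) * (\<integral>\<^sup>+\<omega>. \<phi> k (?y k \<omega>) \<partial>M)" if k: "k \<le> K" for k
  proof -
    let ?N = "PiM ({k} \<times> {1..m k}) (\<lambda>_. D)"
    define B where "B = (\<lambda>\<omega>. \<lambda>z\<in>{k} \<times> {1..m k}. \<xi> (fst z) (snd z) \<omega>)"
    \<comment> \<open>The update as a function of the current point and a batch vector, so that the
      point can be frozen while the batch is integrated out.\<close>
    define U where "U = (\<lambda>x S. x - \<gamma> *\<^sub>R clip ((1 / real (m k)) *\<^sub>R (\<Sum>i = 1..m k. Fo x (S (k, i)))) (lam k))"
    define g where "g = (\<lambda>x S. \<phi> (Suc k) (if x \<in> C k then U x S else x))"
    have y_Suc: "\<phi> (Suc k) (?y (Suc k) \<omega>) = g (?y k \<omega>) (B \<omega>)" for \<omega>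
      by (simp add: g_def U_def B_def Let_def)
    have "(\<lambda>z. Fo (fst z) (snd z (k, i))) \<in> borel_measurable (borel \<Otimes>\<^sub>M ?N)" if "i \<in> {1..m k}" for i
    proof -
      have "(\<lambda>z. (fst z, snd z (k, i))) \<in> borel \<Otimes>\<^sub>M ?N \<rightarrow>\<^sub>M borel \<Otimes>\<^sub>M D"
        using that by (intro measurable_Pair measurable_fst
            measurable_compose[OF measurable_snd measurable_component_singleton]) auto
      from measurable_compose[OF this Fo] show ?thesis by simp
    qed
    then have [measurable]: "(\<lambda>z. \<Sum>i = 1..m k. Fo (fst z) (snd z (k, i))) \<in> borel_measurable (borel \<Otimes>\<^sub>M ?N)"
      by (rule borel_measurable_sum)
    have "(\<lambda>z. g (fst z) (snd z)) \<in> borel_measurable (borel \<Otimes>\<^sub>M ?N)"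
      unfolding g_def U_def by measurable
    then have g_meas: "case_prod g \<in> borel_measurable (borel \<Otimes>\<^sub>M ?N)"
      by (simp add: case_prod_unfold)
    \<comment> \<open>The conditional form of the one-step bound: \<open>x\<close> is deterministic
      and only batch k is random.\<close>
    have fresh: "(\<integral>\<^sup>+\<omega>'. g x (B \<omega>') \<partial>M) \<le> ennreal (exp c) * \<phi> k x" for x
    proof (cases "x \<in> C k")
      case False
      then have "V k x > 2" "V (Suc k) x > 2" using V_mono[of k x] by (auto simp: C_def)
      then have "g x S = \<phi> k x" for S using False by (simp add: g_def \<phi>_def)
      then have "(\<integral>\<^sup>+\<omega>'. g x (B \<omega>') \<partial>M) = 1 * \<phi> k x" by (simp add: emeasure_space_1)
      also have "\<dots> \<le> ennreal (exp c) * \<phi> k x"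
        using c by (intro mult_right_mono) (auto simp flip: ennreal_1 intro!: ennreal_leI)
      finally show ?thesis .
    next
      case True
      define Y where "Y = (\<lambda>\<omega>. (1 / real (m k)) *\<^sub>R (\<Sum>i = 1..m k. Fo x (\<xi> k i \<omega>)))"
      have Vx: "V k x \<le> 2" using True by (simp add: C_def)
      \<comment> \<open>The value 3/2 is a rational bound for the square root of 2. Since
        \<open>W k * R\<close> is at least 1, it puts \<open>x\<close> within 3R/2 of the solution,
        inside the ball where the hypotheses hold.\<close>
      have Wp: "W k * norm (x - xs) \<le> 3 / 2"
      proof (rule power2_le_imp_le)
        show "(W k * norm (x - xs))\<^sup>2 \<le> (3 / 2)\<^sup>2"
          using Vx by (simp add: V_def power_mult_distrib power_divide)
      qed simp
      have xQ: "x \<in> cball xs (2 * R)"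
      proof -
        have "norm (x - xs) * 1 \<le> norm (x - xs) * (W k * R)"
          using W0[of k] by (intro mult_left_mono) auto
        also have "\<dots> = (W k * norm (x - xs)) * R" by simp
        also have "\<dots> \<le> 3 / 2 * R" using Wp \<open>R > 0\<close> by (intro mult_right_mono) auto
        finally show ?thesis using \<open>R > 0\<close> by (simp add: dist_norm norm_minus_commute)
      qed
      have Fx[measurable]: "Fo x \<in> borel_measurable D" using Fo_int by auto
      have var_int: "integrable D (\<lambda>s. (norm (Fo x s - F x))\<^sup>2)"
        and var: "(LINT s|D. (norm (Fo x s - F x))\<^sup>2) \<le> \<sigma>\<^sup>2"
        using assms(8) xQ by (auto simp: bounded_variance_on_def)
      have "indep_vars (\<lambda>_. borel) (\<lambda>i \<omega>. Fo x (\<xi> k i \<omega>)) {1..m k}"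
      proof -
        \<comment> \<open>Independence over the pairs (k, i) is transferred to the index i alone by
          grouping the samples into singleton blocks.\<close>
        have "(\<lambda>S. Fo x (S (k, i))) \<in> borel_measurable (PiM {(k, i)} (\<lambda>_. D))" for i
          by (rule measurable_compose[OF _ Fx]) (auto intro: measurable_component_singleton)
        moreover have "indep_vars (\<lambda>i. PiM {(k, i)} (\<lambda>_. D)) (\<lambda>i \<omega>. \<lambda>z\<in>{(k, i)}. (case z of (k, i) \<Rightarrow> \<xi> k i) \<omega>) {1..m k}"
          by (rule indep_vars_restrict[OF ind]) (auto simp: disjoint_family_on_def)
        ultimately show ?thesis
          using indep_vars_compose2[of "\<lambda>i. PiM {(k, i)} (\<lambda>_. D)"
              "\<lambda>i \<omega>. \<lambda>z\<in>{(k, i)}. (case z of (k, i) \<Rightarrow> \<xi> k i) \<omega>" "{1..m k}"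
              "\<lambda>i S. Fo x (S (k, i))" "\<lambda>_. borel"]
          by simp
      qed
      note samples = this
      have int: "integrable M (\<lambda>\<omega>. h (\<xi> k i \<omega>))"
        and ex: "expectation (\<lambda>\<omega>. h (\<xi> k i \<omega>)) = integral\<^sup>L D h"
        if "integrable D h" "i \<in> {1..m k}" for h :: "'s \<Rightarrow> 'z :: euclidean_space" and i
        using integrable_distr[OF \<xi>[OF that(2)], of h] integral_distr[OF \<xi>[OF that(2)], of h]
          that(1) dist[OF that(2)] by auto
      have Y: "integrable M Y" "expectation Y = F x"
        "integrable M (\<lambda>\<omega>. (norm (Y \<omega> - F x))\<^sup>2)"
        "expectation (\<lambda>\<omega>. (norm (Y \<omega> - F x))\<^sup>2) \<le> \<sigma>\<^sup>2 / real (m k)"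
        unfolding Y_def using batch_mean_moments[OF samples assms(19)[of k], of "F x" "\<sigma>\<^sup>2"]
          int[OF Fo_int] ex[OF Fo_int, of _ x] int[OF var_int] ex[OF var_int] var F[of x]
        by auto
      \<comment> \<open>The batch size condition supplies the factor 27000, against which 1500 q^2
        is needed; the latter is at most 1500 (11/10)^2 = 1815.\<close>
      have cv: "1500 * (\<gamma> * A * q * W k)\<^sup>2 * (\<sigma>\<^sup>2 / real (m k)) \<le> c"
      proof -
        have "27000 * \<gamma>\<^sup>2 * (real K + 1) * \<sigma>\<^sup>2 * A * (W k)\<^sup>2 \<le> real (m k)"
          using assms(20)[OF k, folded A_def] by (simp add: W2 exp_minus field_simps)
        then have "A * 1500 * q\<^sup>2 * (27000 * \<gamma>\<^sup>2 * (real K + 1) * \<sigma>\<^sup>2 * A * (W k)\<^sup>2)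
            \<le> A * 1500 * q\<^sup>2 * real (m k)"
          using A by (intro mult_left_mono) auto
        also have "\<dots> \<le> A * 1500 * (11 / 10)\<^sup>2 * real (m k)"
          using A q by (intro mult_right_mono mult_left_mono power_mono) auto
        also have "\<dots> \<le> 27000 * A * real (m k)"
          using A by (intro mult_right_mono) (auto simp: power2_eq_square)
        finally have "27000 * (1500 * (\<gamma> * A * q * W k)\<^sup>2 * \<sigma>\<^sup>2 * (real K + 1)) \<le> 27000 * (A * real (m k))"
          by (simp add: power2_eq_square algebra_simps)
        then have "1500 * (\<gamma> * A * q * W k)\<^sup>2 * \<sigma>\<^sup>2 * (real K + 1) \<le> A * real (m k)" by linarith
        then show ?thesis
          using assms(19)[of k] by (simp add: c_def pos_le_divide_eq pos_divide_le_eq)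
      qed
      \<comment> \<open>In the exponent 1 + k/2 of the clipping level, the 1 produces
        \<open>q\<close> and the k/2 produces \<open>W k\<close>.\<close>
      have r: "lam k = 1 / (120 * \<gamma> * A * q * W k)"
      proof -
        have "exp (- \<gamma> * \<mu> * (1 + real k / 2)) = 1 / (q * exp (\<gamma> * \<mu> * real k / 2))"
          by (simp add: q_def algebra_simps exp_add exp_diff exp_minus inverse_eq_divide)
        then show ?thesis using assms(18)[of k, folded A_def] by (simp add: W_def mult_ac)
      qed
      \<comment> \<open>The truncation is dropped at the new point, which only increases the value.
        At the old point it is restored for free because \<open>V k x \<le> 2\<close>.\<close>
      have "(\<integral>\<^sup>+\<omega>'. g x (B \<omega>') \<partial>M)
          \<le> (\<integral>\<^sup>+\<omega>'. ennreal (exp (2 * A * (q * (W k)\<^sup>2 * (norm (x - xs - \<gamma> *\<^sub>R clip (Y \<omega>') (lam k)))\<^sup>2))) \<partial>M)"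
      proof (intro nn_integral_mono)
        fix \<omega>'
        have "U x (B \<omega>') - xs = x - xs - \<gamma> *\<^sub>R clip (Y \<omega>') (lam k)"
          by (simp add: U_def B_def Y_def)
        then have "V (Suc k) (U x (B \<omega>')) = q * (W k)\<^sup>2 * (norm (x - xs - \<gamma> *\<^sub>R clip (Y \<omega>') (lam k)))\<^sup>2"
          by (simp only: V_def W_Suc)
        then show "g x (B \<omega>') \<le> ennreal (exp (2 * A * (q * (W k)\<^sup>2 * (norm (x - xs - \<gamma> *\<^sub>R clip (Y \<omega>') (lam k)))\<^sup>2)))"
          using True A by (auto simp: g_def \<phi>_def intro!: ennreal_leI)
      qed
      also have "\<dots> \<le> ennreal (exp c) * ennreal (exp (2 * A * ((W k)\<^sup>2 * (norm (x - xs))\<^sup>2)))"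
        using assms(10,12) xQ
        by (intro clipped_step_exp_moment[where f = "F x" and l = l and \<mu> = \<mu> and v = "\<sigma>\<^sup>2 / real (m k)"]
            assms(9,11,16) A W q \<gamma>lA q\<mu> r Wp Y cv)
          (auto simp: star_cocoercive_on_def quasi_strongly_monotone_on_def)
      also have "\<dots> = ennreal (exp c) * \<phi> k x"
        using Vx by (simp add: \<phi>_def V_def)
      finally show ?thesis .
    qed
    have "(\<integral>\<^sup>+\<omega>. \<phi> (Suc k) (?y (Suc k) \<omega>) \<partial>M) = (\<integral>\<^sup>+\<omega>. (\<integral>\<^sup>+\<omega>'. g (?y k \<omega>) (B \<omega>') \<partial>M) \<partial>M)"
      unfolding y_Suc B_def by (rule nn_integral_stopped_sgda_batch[OF Fo C_meas ind g_meas])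
    also have "\<dots> \<le> (\<integral>\<^sup>+\<omega>. ennreal (exp c) * \<phi> k (?y k \<omega>) \<partial>M)"
      by (intro nn_integral_mono fresh)
    also have "\<dots> = ennreal (exp c) * (\<integral>\<^sup>+\<omega>. \<phi> k (?y k \<omega>) \<partial>M)"
      by (rule nn_integral_cmult) measurable
    finally show ?thesis .
  qed
  have bound: "(\<integral>\<^sup>+\<omega>. \<phi> k (?y k \<omega>) \<partial>M) \<le> ennreal (exp (c * real k + 2 * A))" if "k \<le> Suc K" for k
    using that
  proof (induction k)
    case 0
    have "(W 0 * norm (x0 - xs))\<^sup>2 \<le> 1"
      using assms(6,7) by (simp add: W_def power_le_one)
    then have "V 0 x0 \<le> 1" by (simp add: V_def power_mult_distrib)
    then show ?case using A by (auto simp: \<phi>_def emeasure_space_1 intro!: ennreal_leI)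
  next
    case (Suc k)
    then have "(\<integral>\<^sup>+\<omega>. \<phi> (Suc k) (?y (Suc k) \<omega>) \<partial>M)
      \<le> ennreal (exp c) * ennreal (exp (c * real k + 2 * A))"
      using step[of k] by (meson Suc_le_mono le_SucI mult_left_mono order_trans zero_le)
    also have "\<dots> = ennreal (exp (c * real (Suc k) + 2 * A))"
      by (simp add: algebra_simps flip: ennreal_mult exp_add)
    finally show ?case .
  qed
  \<comment> \<open>Only membership at the final time is recorded, yet by nestedness it says that
    the process never stopped.\<close>
  define S where "S = {\<omega> \<in> space M. ?y (Suc K) \<omega> \<in> C (Suc K)}"
  have S[measurable]: "S \<in> sets M" unfolding S_def by measurable
  have "ennreal (exp (4 * A)) * emeasure M (space M - S)
      = (\<integral>\<^sup>+\<omega>. ennreal (exp (4 * A)) * indicator (space M - S) \<omega> \<partial>M)"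
    by (subst nn_integral_cmult_indicator) auto
  \<comment> \<open>Markov's inequality: outside \<open>S\<close> the truncation is attained, so
    \<phi> equals exp (4 A) there.\<close>
  also have "\<dots> \<le> (\<integral>\<^sup>+\<omega>. \<phi> (Suc K) (?y (Suc K) \<omega>) \<partial>M)"
    by (intro nn_integral_mono) (auto simp: indicator_def S_def C_def \<phi>_def simp del: stopped_sgda.simps)
  also have "\<dots> \<le> ennreal (exp (3 * A))"
    using bound[of "Suc K"] by (simp add: c_def add_ac)
  finally have "exp (4 * A) * prob (space M - S) \<le> exp (3 * A)"
    by (simp add: emeasure_eq_measure flip: ennreal_mult)
  then have "exp (- 4 * A) * (exp (4 * A) * prob (space M - S)) \<le> exp (- 4 * A) * exp (3 * A)"
    by (intro mult_left_mono) auto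
  then have "prob (space M - S) \<le> exp (- A)"
    by (simp flip: exp_add mult.assoc)
  also have "\<dots> = \<beta> / (4 * (real K + 1))"
    using assms(13) by (simp add: A_def exp_minus)
  also have "\<dots> \<le> \<beta>" using assms(13) by (simp add: field_simps)
  finally have "1 - \<beta> \<le> prob S" using prob_compl[OF S] by simp
  also have "\<dots> \<le> \<P>(\<omega> in M. (norm (clipped_sgda Fo \<gamma> lam m \<xi> x0 (K + 1) \<omega> - xs))\<^sup>2
                     \<le> 2 * exp (- \<gamma> * \<mu> * (real K + 1)) * R\<^sup>2)"
  proof (rule finite_measure_mono)
    show "S \<subseteq> {\<omega> \<in> space M. (norm (clipped_sgda Fo \<gamma> lam m \<xi> x0 (K + 1) \<omega> - xs))\<^sup>2
        \<le> 2 * exp (- \<gamma> * \<mu> * (real K + 1)) * R\<^sup>2}"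
    proof safe
      fix \<omega> assume "\<omega> \<in> S"
      then show "\<omega> \<in> space M" by (simp add: S_def)
      have y: "?y (Suc K) \<omega> \<in> C (Suc K)" using \<open>\<omega> \<in> S\<close> unfolding S_def by blast
      define n where "n = (norm (clipped_sgda Fo \<gamma> lam m \<xi> x0 (Suc K) \<omega> - xs))\<^sup>2"
      define e where "e = exp (\<gamma> * \<mu> * (real K + 1))"
      have "e / R\<^sup>2 * n \<le> 2"
        using y clipped_sgda_eq_stopped_sgda[where C = C, OF C_mono y]
        by (simp add: C_def V_def W2 n_def e_def add_ac del: clipped_sgda.simps stopped_sgda.simps)
      then have "n \<le> 2 * (1 / e) * R\<^sup>2"
        using \<open>R > 0\<close> by (simp add: field_simps e_def)
      also have "1 / e = exp (- \<gamma> * \<mu> * (real K + 1))"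
        by (simp add: e_def exp_minus inverse_eq_divide)
      finally show "(norm (clipped_sgda Fo \<gamma> lam m \<xi> x0 (K + 1) \<omega> - xs))\<^sup>2
        \<le> 2 * exp (- \<gamma> * \<mu> * (real K + 1)) * R\<^sup>2"
        by (simp add: n_def del: clipped_sgda.simps)
    qed
    \<comment> \<open>With all regions equal to the whole space nothing is ever stopped, so
      measurability carries over to the original iterates.\<close>
    have "clipped_sgda Fo \<gamma> lam m \<xi> x0 (K + 1) = stopped_sgda (\<lambda>_. UNIV) Fo \<gamma> lam m \<xi> x0 (K + 1)"
      by (rule ext, rule clipped_sgda_eq_stopped_sgda) auto
    then have [measurable]: "clipped_sgda Fo \<gamma> lam m \<xi> x0 (K + 1) \<in> borel_measurable M"
      using stopped_sgda_measurable[OF Fo, of "\<lambda>_. UNIV" "K + 1" m \<xi> M] \<xi> by simp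
    show "{\<omega> \<in> space M. (norm (clipped_sgda Fo \<gamma> lam m \<xi> x0 (K + 1) \<omega> - xs))\<^sup>2
        \<le> 2 * exp (- \<gamma> * \<mu> * (real K + 1)) * R\<^sup>2} \<in> events"
      by measurable
  qed
  finally show ?thesis .
qed

end
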